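(* Let $\mu$ be a finite Borel measure on $\mathbb{R}^d$ with compact support, let $t\in\mathbb{R}^d$, and let $\mu_t$ be the translation of $\mu$ by $t$. Then $$\dim_{\mathrm{F}}(\mu+\mu_t)=\dim_{\mathrm{F}}\mu.$$
   Context: The translation of $\mu$ by $t$ is the image of $\mu$ under $x\mapsto x+t$. For a finite Borel measure $\mu$ on $\mathbb{R}^d$, $\widehat\mu(\xi)=\int e^{-2\pi i \xi\cdot x}\,d\mu(x)$ for $\xi\in\mathbb{R}^d$. The notation $f(\xi)\lesssim g(\xi)$ means there is a constant $C$ with $|f(\xi)|\le C|g(\xi)|$ for all $\xi$ (negative powers of $|\xi|$ are read as $+\infty$ at $\xi=0$). The Fourier dimension of $\mu$ is $\dim_{\mathrm{F}}\mu=\sup\{s\in[0,d]:\ \widehat\mu(\xi)\lesssim|\xi|^{-s/2}\}$. *)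

theory Defs
  imports "HOL-Analysis.Analysis"
begin

definition finite_borel_measure :: "'a::topological_space measure \<Rightarrow> bool" where
  "finite_borel_measure M \<longleftrightarrow> sets M = sets borel \<and> finite_measure M"

definition measure_support :: "'a::topological_space measure \<Rightarrow> 'a set" where
  "measure_support M = {x. \<forall>U. open U \<longrightarrow> x \<in> U \<longrightarrow> 0 < emeasure M U}"

definition translate_measure :: "'a::euclidean_space \<Rightarrow> 'a measure \<Rightarrow> 'a measure" where
  "translate_measure t M = distr M borel (\<lambda>x. x + t)"

text \<open>The supremum \<open>sup\<close> on measures is the lattice supremum, so the
  setwise sum needs a definition of its own. It is meant for measures with the same
  measurable sets, for which \<open>emeasure_add_measure\<close> below shows that it has the intended values.\<close>

definition add_measure :: "'a measure \<Rightarrow> 'a measure \<Rightarrow> 'a measure" where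
  "add_measure M N = measure_of (space M) (sets M) (\<lambda>A. emeasure M A + emeasure N A)"

lemma space_add_measure [simp]: "space (add_measure M N) = space M"
  by (simp add: add_measure_def)

lemma sets_add_measure [simp]: "sets (add_measure M N) = sets M"
  by (simp add: add_measure_def)

lemma emeasure_add_measure:
  assumes "sets N = sets M" "A \<in> sets M"
  shows "emeasure (add_measure M N) A = emeasure M A + emeasure N A"
proof (rule emeasure_measure_of[OF add_measure_def])
  show "sets M \<subseteq> Pow (space M)"
    by (rule sets.space_closed)
  show "A \<in> sets (add_measure M N)"
    using assms by simp
  show "positive (sets (add_measure M N)) (\<lambda>A. emeasure M A + emeasure N A)"
    by (simp add: positive_def)
  show "countably_additive (sets (add_measure M N)) (\<lambda>A. emeasure M A + emeasure N A)"
  proof (rule countably_additiveI)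
    fix F :: "nat \<Rightarrow> 'a set"
    assume F: "range F \<subseteq> sets (add_measure M N)" "disjoint_family F"
    then have "(\<Sum>i. emeasure M (F i)) = emeasure M (\<Union>i. F i)"
      and "(\<Sum>i. emeasure N (F i)) = emeasure N (\<Union>i. F i)"
      using assms(1) by (auto intro!: suminf_emeasure)
    then show "(\<Sum>i. emeasure M (F i) + emeasure N (F i)) =
        emeasure M (\<Union>i. F i) + emeasure N (\<Union>i. F i)"
      by (subst suminf_add[symmetric]) auto
  qed
qed

definition fourier_transform :: "'a::euclidean_space measure \<Rightarrow> 'a \<Rightarrow> complex" where
  "fourier_transform M \<xi> =
     (LINT x|M. exp (- 2 * complex_of_real pi * \<i> * complex_of_real (\<xi> \<bullet> x)))"

definition lesssim :: "('a \<Rightarrow> complex) \<Rightarrow> ('a \<Rightarrow> ereal) \<Rightarrow> bool" (infix \<open>\<lesssim>\<close> 50) where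
  "f \<lesssim> g \<longleftrightarrow> (\<exists>C::real. \<forall>\<xi>. ereal (norm (f \<xi>)) \<le> ereal C * \<bar>g \<xi>\<bar>)"

text \<open>The power \<open>|\<xi>|\<^sup>a\<close> for \<open>a \<le> 0\<close>: a negative power of \<open>0\<close> is \<open>\<infinity>\<close>, and the zeroth power is
  \<open>1\<close> everywhere. The case distinction is needed because \<open>0 powr a = 0\<close> for all \<open>a\<close>,
  including \<open>a = 0\<close>.\<close>

definition norm_power :: "real \<Rightarrow> 'a::real_normed_vector \<Rightarrow> ereal" where
  "norm_power a \<xi> =
     (if \<xi> = 0 then (if a = 0 then 1 else \<infinity>) else ereal (norm \<xi> powr a))"

definition fourier_dim :: "'a::euclidean_space measure \<Rightarrow> real" where
  "fourier_dim M =
     Sup {s \<in> {0..real DIM('a)}. fourier_transform M \<lesssim> norm_power (- s / 2)}"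

end

theory Submission
  imports Defs
begin

text \<open>Since \<open>\<nu> = \<mu> + \<mu>\<^sub>t\<close> has Fourier transform \<open>(1 + e(-\<xi> \<bullet> t)) \<mu>^(\<xi>)\<close>, the only difficulty is
  to bound \<open>\<mu>^\<close> near the zeros of the factor, where \<open>\<xi> \<bullet> t\<close> is a half-integer. The support being
  bounded, the \<open>k\<close>-th order difference of \<open>\<mu>^\<close> with step \<open>w\<close> is \<open>O(|w|\<^sup>k)\<close>, so \<open>|\<mu>^(\<xi>)|\<close> is at
  most a combination of the values \<open>|\<mu>^(\<xi> + j w)|\<close>, \<open>1 \<le> j \<le> k\<close>, up to this error. For \<open>w\<close> a
  multiple of \<open>t\<close> of length about \<open>|\<xi>| powr -\<epsilon>\<close>, pointing away from the nearest zero, the factor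
  at these points is at least of order \<open>|\<xi>| powr -\<epsilon>\<close>. Hence a decay exponent \<open>s/2\<close> of \<open>\<nu>^\<close> gives
  the exponent \<open>s/2 - \<epsilon>\<close> for \<open>\<mu>^\<close> as soon as \<open>k \<epsilon> \<ge> s/2\<close>. The loss \<open>\<epsilon>\<close> is harmless for the
  supremum.\<close>

section \<open>Sums of measures\<close>

text \<open>Both summands lie below the sum in the order on measures, so integrability for the sum
  passes down to each of them. Then induction on integrable functions applies: indicators reduce to
  additivity of the measures, and limits to dominated convergence for all three measures.\<close>

lemma integral_add_measure:
  fixes f :: "'a \<Rightarrow> 'b::{banach, second_countable_topology}"
  assumes sets: "sets N = sets M" and f: "integrable (add_measure M N) f"
  shows "integral\<^sup>L (add_measure M N) f = integral\<^sup>L M f + integral\<^sup>L N f"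
proof -
  let ?P = "add_measure M N"
  have space: "space N = space M"
    using sets by (rule sets_eq_imp_space_eq)
  have le_P: "M \<le> ?P" "N \<le> ?P"
    using sets by (simp_all add: le_measure emeasure_add_measure)
  have integrable_le: "integrable Q g"
    if "Q \<le> ?P" "sets Q = sets M" "integrable ?P g" for Q and g :: "'a \<Rightarrow> 'b"
  proof -
    have "(\<integral>\<^sup>+x. norm (g x) \<partial>Q) \<le> (\<integral>\<^sup>+x. norm (g x) \<partial>?P)"
      using that by (intro nn_integral_mono_measure) simp_all
    moreover have "g \<in> borel_measurable Q"
      using borel_measurable_integrable[OF that(3)] that(2) by (simp cong: measurable_cong_sets)
    ultimately show ?thesis
      using that(3) by (auto simp: integrable_iff_bounded intro: le_less_trans)
  qed
  have int: "integrable M g" "integrable N g" if "integrable ?P g" for g :: "'a \<Rightarrow> 'b"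
    using integrable_le[OF le_P(1) _ that] integrable_le[OF le_P(2) _ that] sets by auto
  from f show ?thesis
  proof (induction rule: integrable_induct)
    case (base A c)
    then have fin: "emeasure M A < \<infinity>" "emeasure N A < \<infinity>" "A \<in> sets N"
      using sets by (auto simp: emeasure_add_measure)
    then have "measure ?P A = measure M A + measure N A"
      using base sets by (simp add: measure_def emeasure_add_measure enn2real_plus)
    then show ?case
      using base fin by (simp add: scaleR_add_left)
  next
    case (add f g)
    then show ?case
      using int[OF add.hyps(1)] int[OF add.hyps(2)] add.IH by simp
  next
    case (lim f s)
    \<comment> \<open>The dominating function \<open>2 * norm (f x)\<close> is the bound on the
      approximating sequence that the induction rule supplies.\<close>
    have conv: "(\<lambda>i. integral\<^sup>L Q (s i)) \<longlonglongrightarrow> integral\<^sup>L Q f"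
      if "integrable Q f" "\<And>i. integrable Q (s i)" "space Q = space M" for Q
      by (rule integral_dominated_convergence[where w = "\<lambda>x. 2 * norm (f x)"])
        (use that lim.hyps(2,3) in \<open>auto intro: borel_measurable_integrable\<close>)
    have "(\<lambda>i. integral\<^sup>L ?P (s i)) \<longlonglongrightarrow> integral\<^sup>L M f + integral\<^sup>L N f"
      unfolding lim.IH
      by (intro tendsto_add conv int lim.hyps(1,4) space refl)
    moreover have "(\<lambda>i. integral\<^sup>L ?P (s i)) \<longlonglongrightarrow> integral\<^sup>L ?P f"
      by (rule conv) (use lim.hyps in auto)
    ultimately show ?case
      by (rule LIMSEQ_unique[rotated])
  qed
qed

lemma finite_measure_add_measure:
  assumes "sets N = sets M" "finite_measure M" "finite_measure N"
  shows "finite_measure (add_measure M N)"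
proof
  have "space M \<in> sets M"
    by simp
  then show "emeasure (add_measure M N) (space (add_measure M N)) \<noteq> \<infinity>"
    using finite_measure.emeasure_finite[OF assms(2)] finite_measure.emeasure_finite[OF assms(3)]
      emeasure_add_measure[OF assms(1)] by simp
qed

text \<open>The complement of the support is covered by the open null sets. By Lindelof countably
  many of these have the same union, which is therefore null.\<close>

lemma AE_in_measure_support:
  fixes M :: "'a::{second_countable_topology} measure"
  assumes "sets M = sets borel"
  shows "AE x in M. x \<in> measure_support M"
proof -
  define \<F> where "\<F> = {U. open U \<and> emeasure M U = 0}"
  obtain \<F>' where \<F>': "\<F>' \<subseteq> \<F>" "countable \<F>'" "\<Union>\<F>' = \<Union>\<F>"
    using Lindelof[of \<F>] by (auto simp: \<F>_def)
  have "(\<Union>U\<in>\<F>'. U) \<in> null_sets M"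
    using \<F>' assms by (intro null_sets_UN') (auto simp: \<F>_def null_sets_def)
  moreover have "- measure_support M \<subseteq> \<Union>\<F>"
    by (auto simp: measure_support_def \<F>_def)
  ultimately show ?thesis
    using \<F>'(3) by (auto intro!: AE_I'[of "\<Union>\<F>"])
qed

section \<open>Fourier transforms\<close>

lemma fourier_transform_cis:
  "fourier_transform M \<xi> = (LINT x|M. cis (- 2 * pi * (\<xi> \<bullet> x)))"
  unfolding fourier_transform_def cis_conv_exp by (simp add: mult_ac)

lemma measurable_cis_inner [measurable]:
  fixes v :: "'a::euclidean_space"
  shows "(\<lambda>x. cis (c * (v \<bullet> x))) \<in> borel_measurable borel"
  by (intro borel_measurable_continuous_onI continuous_intros)

lemma integrable_cis_inner:
  fixes M :: "'a::euclidean_space measure"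
  assumes "finite_borel_measure M"
  shows "integrable M (\<lambda>x. cis (c * (v \<bullet> x)))"
proof -
  interpret finite_measure M
    using assms by (simp add: finite_borel_measure_def)
  have "(\<lambda>x. cis (c * (v \<bullet> x))) \<in> borel_measurable M"
    using assms by (simp add: finite_borel_measure_def cong: measurable_cong_sets)
  then show ?thesis
    by (intro integrable_const_bound[where B = 1]) auto
qed

lemma norm_fourier_transform_le:
  assumes "finite_borel_measure M"
  shows "norm (fourier_transform M \<xi>) \<le> measure M (space M)"
proof -
  have "norm (fourier_transform M \<xi>) \<le> (LINT x|M. norm (cis (- 2 * pi * (\<xi> \<bullet> x))))"
    unfolding fourier_transform_cis by (rule integral_norm_bound)
  then show ?thesis
    by simp
qed

lemma finite_borel_measure_translate:
  assumes "finite_borel_measure M"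
  shows "finite_borel_measure (translate_measure t M)"
proof -
  have M: "sets M = sets borel" "finite_measure M"
    using assms by (simp_all add: finite_borel_measure_def)
  have "(\<lambda>x. x + t) \<in> measurable M borel"
    using M(1) by (simp cong: measurable_cong_sets)
  then show ?thesis
    using finite_measure.finite_measure_distr[OF M(2)]
    by (simp add: finite_borel_measure_def translate_measure_def)
qed

lemma fourier_transform_add_translate:
  assumes M: "finite_borel_measure M"
  shows "fourier_transform (add_measure M (translate_measure t M)) \<xi> =
    (1 + cis (- 2 * pi * (\<xi> \<bullet> t))) * fourier_transform M \<xi>"
proof -
  let ?N = "translate_measure t M"
  have sets: "sets M = sets borel" "sets ?N = sets M"
    using M by (simp_all add: finite_borel_measure_def translate_measure_def)
  have "finite_borel_measure (add_measure M ?N)"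
    using M finite_borel_measure_translate[OF M, of t] sets
    by (auto simp: finite_borel_measure_def intro: finite_measure_add_measure)
  then have "fourier_transform (add_measure M ?N) \<xi> = fourier_transform M \<xi> + fourier_transform ?N \<xi>"
    unfolding fourier_transform_cis
    by (intro integral_add_measure sets(2) integrable_cis_inner)
  also have "fourier_transform ?N \<xi> = (LINT x|M. cis (- 2 * pi * (\<xi> \<bullet> (x + t))))"
    unfolding fourier_transform_cis translate_measure_def
    by (intro integral_distr measurable_cis_inner)
      (use sets(1) in \<open>simp cong: measurable_cong_sets\<close>)
  also have "\<dots> = (LINT x|M. cis (- 2 * pi * (\<xi> \<bullet> t)) * cis (- 2 * pi * (\<xi> \<bullet> x)))"
    by (simp add: cis_mult inner_add_right algebra_simps)
  also have "\<dots> = cis (- 2 * pi * (\<xi> \<bullet> t)) * fourier_transform M \<xi>"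
    unfolding fourier_transform_cis
    by (intro integral_mult_right_zero)
  finally show ?thesis
    by (simp add: algebra_simps)
qed

lemma norm_one_minus_cis_le: "norm (1 - cis x) \<le> \<bar>x\<bar>"
proof -
  have "norm (1 - cis x) = 2 * \<bar>sin (x / 2)\<bar>"
    using dist_exp_i_1[of x] by (simp add: cis_conv_exp norm_minus_commute)
  also have "\<dots> \<le> \<bar>x\<bar>"
    using abs_sin_x_le_abs_x[of "x / 2"] by simp
  finally show ?thesis .
qed

text \<open>By the binomial theorem, differencing under the integral multiplies the character at
  \<open>\<xi>\<close> by the k-th power of 1 - e(-w.x). On the ball of radius \<open>R\<close> each
  factor is at most \<open>2 * pi * norm w * R\<close>.\<close>

lemma norm_fourier_difference_le:
  assumes M: "finite_borel_measure M" and R: "AE x in M. norm x \<le> R"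
  shows "norm (\<Sum>j\<le>k. of_nat (k choose j) * (- 1) ^ j * fourier_transform M (\<xi> + real j *\<^sub>R w))
    \<le> (2 * pi * norm w * R) ^ k * measure M (space M)"
proof -
  interpret finite_measure M
    using M by (simp add: finite_borel_measure_def)
  let ?e = "\<lambda>v x. cis (- 2 * pi * (v \<bullet> x))"
  have e_add: "?e (\<xi> + real j *\<^sub>R w) x = ?e \<xi> x * ?e w x ^ j" for j x
    by (simp add: inner_add_left Complex.DeMoivre cis_mult algebra_simps)
  have "(\<Sum>j\<le>k. of_nat (k choose j) * (- 1) ^ j * fourier_transform M (\<xi> + real j *\<^sub>R w))
    = (LINT x|M. (\<Sum>j\<le>k. of_nat (k choose j) * (- 1) ^ j * ?e (\<xi> + real j *\<^sub>R w) x))"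
    unfolding fourier_transform_cis
    by (subst Bochner_Integration.integral_sum)
      (intro integrable_mult_right integrable_cis_inner M, simp)
  also have "\<dots> = (LINT x|M. ?e \<xi> x * (1 - ?e w x) ^ k)"
  proof (rule Bochner_Integration.integral_cong[OF refl])
    fix x
    have "(1 - ?e w x) ^ k = (- ?e w x + 1) ^ k"
      by simp
    also have "\<dots> = (\<Sum>j\<le>k. of_nat (k choose j) * (- ?e w x) ^ j)"
      by (subst binomial_ring) simp
    also have "\<dots> = (\<Sum>j\<le>k. of_nat (k choose j) * (- 1) ^ j * ?e w x ^ j)"
      by (intro sum.cong refl, subst power_minus) (simp add: mult_ac)
    finally show "(\<Sum>j\<le>k. of_nat (k choose j) * (- 1) ^ j * ?e (\<xi> + real j *\<^sub>R w) x)
        = ?e \<xi> x * (1 - ?e w x) ^ k"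
      unfolding e_add by (simp only: sum_distrib_left mult_ac)
  qed
  also have "norm \<dots> \<le> (LINT x|M. norm (?e \<xi> x * (1 - ?e w x) ^ k))"
    by (rule integral_norm_bound)
  also have "\<dots> \<le> (LINT x|M. (2 * pi * norm w * R) ^ k)"
  proof (rule integral_mono_AE)
    have bound: "norm (?e \<xi> x * (1 - ?e w x) ^ k) \<le> (2 * pi * norm w * R) ^ k"
      if "norm x \<le> R" for x
    proof -
      have "norm (1 - ?e w x) \<le> \<bar>- 2 * pi * (w \<bullet> x)\<bar>"
        by (rule norm_one_minus_cis_le)
      also have "\<dots> \<le> 2 * pi * (norm w * norm x)"
        using Cauchy_Schwarz_ineq2[of w x] by (simp add: abs_mult)
      also have "\<dots> \<le> 2 * pi * norm w * R"
        using that by (simp add: mult_left_mono mult.assoc)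
      finally show ?thesis
        by (simp add: norm_mult norm_power power_mono)
    qed
    show AE: "AE x in M. norm (?e \<xi> x * (1 - ?e w x) ^ k) \<le> (2 * pi * norm w * R) ^ k"
      using R by eventually_elim (rule bound)
    have "(\<lambda>x. ?e \<xi> x * (1 - ?e w x) ^ k) \<in> borel_measurable borel"
      by measurable
    then have "(\<lambda>x. ?e \<xi> x * (1 - ?e w x) ^ k) \<in> borel_measurable M"
      using M by (simp add: finite_borel_measure_def cong: measurable_cong_sets)
    with AE show "integrable M (\<lambda>x. norm (?e \<xi> x * (1 - ?e w x) ^ k))"
      by (intro integrable_norm integrable_const_bound)
  qed simp
  also have "\<dots> = (2 * pi * norm w * R) ^ k * measure M (space M)"
    by simp
  finally show ?thesis .
qed

section \<open>Staying away from the zeros\<close>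

text \<open>Pulling out the unimodular factor \<open>cis (x / 2)\<close> leaves the real number 2
  cos(x/2).\<close>

lemma norm_one_plus_cis: "norm (1 + cis x) = 2 * \<bar>cos (x / 2)\<bar>"
proof -
  have "1 + cis x = cis (x / 2) * (2 * of_real (cos (x / 2)))"
  proof -
    have "cis (x / 2) * cis (x / 2) = cis x" "cis (x / 2) * cis (- (x / 2)) = 1"
      by (simp_all add: cis_mult)
    moreover have "cis (x / 2) + cis (- (x / 2)) = 2 * of_real (cos (x / 2))"
      by (simp add: complex_eq_iff)
    ultimately show ?thesis
      by (metis add.commute distrib_left)
  qed
  then show ?thesis
    by (simp add: norm_mult)
qed

lemma half_le_sin:
  assumes "0 \<le> x" "x \<le> pi / 4"
  shows "x / 2 \<le> sin x"
proof (cases "x = 0")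
  case False
  then obtain z where z: "0 < z" "z < x" "sin x - sin 0 = (x - 0) * cos z"
    using MVT2[of 0 x sin cos] assms by (auto intro: DERIV_sin)
  have "cos (pi / 3) \<le> cos z"
    using z assms by (intro cos_monotone_0_pi_le) auto
  then show ?thesis
    using z assms mult_left_mono[of "1/2" "cos z" x] by (simp add: cos_60)
qed simp

text \<open>One choice of direction has to serve all \<open>j\<close> at once. The zeros are the
  half-integers; moving away from the nearest one by at most 1/4 in total does not come too close to
  the next one.\<close>

lemma norm_one_plus_cis_ge:
  fixes a h :: real
  assumes h: "0 < h" "real k * h \<le> 1 / 4"
  obtains \<eta> :: real where "\<bar>\<eta>\<bar> = h"
    "\<And>j. j \<in> {1..k} \<Longrightarrow> h \<le> norm (1 + cis (- 2 * pi * (a + real j * \<eta>)))"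
proof -
  \<comment> \<open>The product is sin(2 pi a)/2, whose sign tells on which side of \<open>a\<close>
    the nearest half-integer lies: on the left when it is negative.\<close>
  define \<eta> where "\<eta> = (if sin (pi * a) * cos (pi * a) \<le> 0 then h else - h)"
  have "\<bar>\<eta>\<bar> = h"
    using h by (simp add: \<eta>_def)
  moreover have "h \<le> norm (1 + cis (- 2 * pi * (a + real j * \<eta>)))" if j: "j \<in> {1..k}" for j
  proof -
    define b where "b = pi * (real j * h)"
    have jh: "h \<le> real j * h" "real j * h \<le> 1 / 4"
      using j h order_trans[OF mult_right_mono[of "real j" "real k" h] h(2)] by auto
    then have b: "0 \<le> b" "b \<le> pi / 4"
      using h(1) mult_left_mono[OF jh(2), of pi] by (simp_all add: b_def)
    have "h \<le> real j * h" by (rule jh)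
    also have "\<dots> \<le> 2 * (b / 2)"
      using h(1) pi_gt3 mult_right_mono[of 1 pi "real j * h"] by (simp add: b_def)
    also have "b / 2 \<le> sin b"
      using b by (rule half_le_sin)
    finally have h_le: "h \<le> 2 * sin b" by simp
    have sin_nonneg: "0 \<le> sin b" and cos_nonneg: "0 \<le> cos b" and "sin b \<le> cos b"
    proof -
      show "0 \<le> sin b" "0 \<le> cos b"
        using b pi_gt_zero by (auto intro: sin_ge_zero cos_ge_zero)
      have "cos (pi / 2 - b) \<le> cos b"
        using b pi_gt_zero by (intro cos_monotone_0_pi_le) auto
      then show "sin b \<le> cos b"
        by (simp add: sin_cos_eq)
    qed
    \<comment> \<open>The sign of \<open>\<eta>\<close> makes both terms of the addition formula for
      \<open>cos (pi * (a + j * \<eta>))\<close> have the same sign.\<close>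
    have eq: "\<bar>cos (pi * (a + real j * \<eta>))\<bar> = \<bar>cos (pi * a) * cos b\<bar> + \<bar>sin (pi * a) * sin b\<bar>"
    proof -
      have prod: "(cos (pi * a) * cos b) * (sin (pi * a) * sin b)
          = (sin (pi * a) * cos (pi * a)) * (sin b * cos b)"
        by simp
      show ?thesis
      proof (cases "sin (pi * a) * cos (pi * a) \<le> 0")
        case True
        then have "cos (pi * (a + real j * \<eta>)) = cos (pi * a) * cos b - sin (pi * a) * sin b"
          by (simp add: \<eta>_def b_def distrib_left cos_add)
        moreover have "(cos (pi * a) * cos b) * (sin (pi * a) * sin b) \<le> 0"
          unfolding prod by (rule mult_nonpos_nonneg[OF True mult_nonneg_nonneg[OF sin_nonneg cos_nonneg]])
        ultimately show ?thesis
          unfolding mult_le_0_iff[of "cos (pi * a) * cos b"] by linarith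
      next
        case False
        then have "cos (pi * (a + real j * \<eta>)) = cos (pi * a) * cos b + sin (pi * a) * sin b"
          by (simp add: \<eta>_def b_def right_diff_distrib cos_diff)
        moreover have "0 \<le> (cos (pi * a) * cos b) * (sin (pi * a) * sin b)"
          unfolding prod using False by (intro mult_nonneg_nonneg[OF _ mult_nonneg_nonneg[OF sin_nonneg cos_nonneg]]) simp
        ultimately show ?thesis
          unfolding zero_le_mult_iff[of "cos (pi * a) * cos b"] by linarith
      qed
    qed
    \<comment> \<open>Since |cos| + |sin| >= 1 and sin b <= cos b, the sum of absolute values in
      \<open>eq\<close> is at least sin b, wherever \<open>a\<close> lies.\<close>
    have "sin b \<le> (\<bar>cos (pi * a)\<bar> + \<bar>sin (pi * a)\<bar>) * sin b"
    proof -
      have "1 = \<bar>cos (pi * a)\<bar>\<^sup>2 + \<bar>sin (pi * a)\<bar>\<^sup>2"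
        by simp
      also have "\<dots> \<le> \<bar>cos (pi * a)\<bar> * 1 + \<bar>sin (pi * a)\<bar> * 1"
        unfolding power2_eq_square by (intro add_mono mult_left_mono) auto
      finally show ?thesis
        using sin_nonneg mult_right_mono by fastforce
    qed
    also have "\<dots> \<le> \<bar>cos (pi * a)\<bar> * cos b + \<bar>sin (pi * a)\<bar> * sin b"
      using \<open>sin b \<le> cos b\<close> by (simp add: distrib_right mult_left_mono)
    finally have "sin b \<le> \<bar>cos (pi * (a + real j * \<eta>))\<bar>"
      using eq sin_nonneg cos_nonneg by (simp add: abs_mult)
    moreover have "norm (1 + cis (- 2 * pi * (a + real j * \<eta>))) = 2 * \<bar>cos (pi * (a + real j * \<eta>))\<bar>"
      unfolding norm_one_plus_cis by simp
    ultimately show ?thesis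
      using h_le by linarith
  qed
  ultimately show ?thesis
    by (rule that)
qed

section \<open>Transfer of the decay\<close>

lemma fourier_decay_from_translate_sum:
  fixes t :: "'a::euclidean_space"
  assumes M: "finite_borel_measure M" and R: "AE x in M. norm x \<le> R" and "0 \<le> R"
    and "t \<noteq> 0" and s': "0 \<le> s'" "s' < s"
    and C: "\<And>\<xi>. \<xi> \<noteq> 0 \<Longrightarrow>
      norm ((1 + cis (- 2 * pi * (\<xi> \<bullet> t))) * fourier_transform M \<xi>) \<le> C * norm \<xi> powr (- s / 2)"
  shows "\<exists>C'. \<forall>\<xi>. \<xi> \<noteq> 0 \<longrightarrow> norm (fourier_transform M \<xi>) \<le> C' * norm \<xi> powr (- s' / 2)"
proof -
  define f where "f = fourier_transform M"
  define m where "m = measure M (space M)"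
  \<comment> \<open>Normalised so that a step \<open>\<eta> *\<^sub>R v\<close> in frequency shifts
    the phase \<open>\<xi> \<bullet> t\<close> by exactly \<open>\<eta>\<close>.\<close>
  define v where "v = t /\<^sub>R (t \<bullet> t)"
  \<comment> \<open>Dividing the decay of order s/2 by a factor of order
    \<open>x powr (- \<epsilon>)\<close> then leaves exactly order s'/2.\<close>
  define \<epsilon> where "\<epsilon> = (s - s') / 2"
  have "v \<bullet> t = 1" "v \<noteq> 0"
    using \<open>t \<noteq> 0\<close> by (simp_all add: v_def)
  have "\<epsilon> > 0"
    using s' by (simp add: \<epsilon>_def)
  \<comment> \<open>The order of the difference is taken so large that the error, of order
    \<open>(x powr (- \<epsilon>)) ^ k\<close>, decays at least as fast as
    \<open>x powr (- s' / 2)\<close>.\<close>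
  obtain k :: nat where "s' / 2 / \<epsilon> < real k"
    using reals_Archimedean2 by blast
  then have k: "s' / 2 \<le> \<epsilon> * real k"
    using \<open>\<epsilon> > 0\<close> by (simp add: field_simps)
  \<comment> \<open>Small enough for two purposes: the total phase shift is at most 1/4, and the
    shifted frequencies stay within 1/4 of \<open>\<xi>\<close>.\<close>
  define c where "c = 1 / (4 * (real k + 1) * (1 + norm v))"
  have den: "0 < 4 * (real k + 1) * (1 + norm v)"
    by (intro mult_pos_pos) (simp_all add: add_pos_nonneg)
  then have "c > 0"
    by (simp add: c_def)
  have c_le: "real k * c * (1 + norm v) \<le> 1 / 4"
    using \<open>v \<noteq> 0\<close> by (simp add: c_def divide_simps add_nonneg_eq_0_iff)
  have c_le': "real k * c \<le> 1 / 4" "real k * c * norm v \<le> 1 / 4"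
  proof -
    have "0 \<le> real k * c" "0 \<le> real k * c * norm v"
      using \<open>c > 0\<close> by simp_all
    with c_le show "real k * c \<le> 1 / 4" "real k * c * norm v \<le> 1 / 4"
      unfolding distrib_left by linarith+
  qed
  \<comment> \<open>\<open>A\<close> bounds the values at the shifted points, with the power of 1/2
    coming from \<open>x / 2 \<le> norm \<zeta>\<close>. \<open>B\<close> bounds the difference, and
    the maximum with \<open>m\<close> in \<open>C'\<close> takes care of the unit ball.\<close>
  define A where "A = \<bar>C\<bar> / c * (1 / 2) powr (- s / 2)"
  define B where "B = (2 * pi * (c * norm v) * R) ^ k * m"
  define C' where "C' = max m ((\<Sum>j\<in>{1..k}. real (k choose j) * A) + B)"
  have m: "0 \<le> m" "norm (f \<xi>) \<le> m" for \<xi>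
    using norm_fourier_transform_le[OF M] by (simp_all add: m_def f_def)
  have "norm (f \<xi>) \<le> C' * norm \<xi> powr (- s' / 2)" if "\<xi> \<noteq> 0" for \<xi>
  proof (cases "norm \<xi> \<le> 1")
    case True
    then have "1 \<le> norm \<xi> powr (- s' / 2)"
      using that s' powr_mono2'[of "- s' / 2" "norm \<xi>" 1] by simp
    then have "m * 1 \<le> C' * norm \<xi> powr (- s' / 2)"
      using m(1) by (intro mult_mono) (simp_all add: C'_def)
    then show ?thesis
      using m(2)[of \<xi>] by simp
  next
    case False
    define x where "x = norm \<xi>"
    define h where "h = c * x powr (- \<epsilon>)"
    have x: "1 < x"
      using False by (simp add: x_def)
    have "x powr (- \<epsilon>) \<le> 1"
      using x \<open>\<epsilon> > 0\<close> powr_mono[of "- \<epsilon>" 0 x] by simp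
    then have h: "0 < h" "h \<le> c"
      using x \<open>c > 0\<close> by (simp_all add: h_def mult_left_le)
    have "real k * h \<le> 1 / 4"
      using mult_left_mono[OF h(2), of "real k"] c_le' by simp
    with h(1) obtain \<eta> :: real where \<eta>: "\<bar>\<eta>\<bar> = h"
      "\<And>j. j \<in> {1..k} \<Longrightarrow> h \<le> norm (1 + cis (- 2 * pi * (\<xi> \<bullet> t + real j * \<eta>)))"
      using norm_one_plus_cis_ge[of h k "\<xi> \<bullet> t"] by blast
    define w where "w = \<eta> *\<^sub>R v"
    have norm_w: "norm w = h * norm v"
      using \<eta>(1) by (simp add: w_def)
    have point: "norm (f (\<xi> + real j *\<^sub>R w)) \<le> A * x powr (- s' / 2)" if j: "j \<in> {1..k}" for j
    proof -
      define \<zeta> where "\<zeta> = \<xi> + real j *\<^sub>R w"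
      have "norm (real j *\<^sub>R w) \<le> real k * (c * norm v)"
        using j h norm_w by (simp add: mult_mono mult_right_mono)
      then have "norm (real j *\<^sub>R w) \<le> 1 / 4"
        using c_le' by (simp add: mult.assoc)
      moreover have "x \<le> norm \<zeta> + norm (real j *\<^sub>R w)"
        unfolding x_def \<zeta>_def using norm_diff_ineq[of \<xi> "real j *\<^sub>R w"] by simp
      \<comment> \<open>Here x - 1/4 >= x/2 because x > 1.\<close>
      ultimately have \<zeta>: "x / 2 \<le> norm \<zeta>" "\<zeta> \<noteq> 0"
        using x by auto
      have "\<zeta> \<bullet> t = \<xi> \<bullet> t + real j * \<eta>"
        using \<open>v \<bullet> t = 1\<close> by (simp add: \<zeta>_def w_def inner_add_left)
      then have "h * norm (f \<zeta>) \<le> norm (1 + cis (- 2 * pi * (\<zeta> \<bullet> t))) * norm (f \<zeta>)"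
        using \<eta>(2)[OF j] by (simp add: mult_right_mono)
      also have "\<dots> \<le> C * norm \<zeta> powr (- s / 2)"
        using C[OF \<zeta>(2)] by (simp add: f_def norm_mult)
      also have "\<dots> \<le> \<bar>C\<bar> * norm \<zeta> powr (- s / 2)"
        by (simp add: mult_right_mono)
      also have "\<dots> \<le> \<bar>C\<bar> * (x / 2) powr (- s / 2)"
        using \<zeta> x s' by (intro mult_left_mono powr_mono2') auto
      finally have "norm (f \<zeta>) \<le> \<bar>C\<bar> * (x / 2) powr (- s / 2) / h"
        using h(1) by (simp add: field_simps)
      also have "\<dots> = A * (x powr (- s / 2) / x powr (- \<epsilon>))"
        using x powr_mult[of x "1/2" "- s / 2"] by (simp add: A_def h_def)
      also have "x powr (- s / 2) / x powr (- \<epsilon>) = x powr (- s' / 2)"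
        unfolding powr_diff[symmetric] by (simp add: \<epsilon>_def field_simps)
      finally show ?thesis
        by (simp add: \<zeta>_def)
    qed
    have error: "(2 * pi * norm w * R) ^ k * m \<le> B * x powr (- s' / 2)"
    proof -
      have "(2 * pi * norm w * R) ^ k * m = B * (x powr (- \<epsilon>)) ^ k"
        by (simp add: B_def norm_w h_def power_mult_distrib)
      also have "(x powr (- \<epsilon>)) ^ k = x powr (- \<epsilon> * real k)"
        using x by (subst powr_realpow[symmetric]) (simp_all add: powr_powr)
      also have "B * x powr (- \<epsilon> * real k) \<le> B * x powr (- s' / 2)"
        using x k \<open>c > 0\<close> \<open>0 \<le> R\<close> m(1) by (intro mult_left_mono powr_mono) (simp_all add: B_def)
      finally show ?thesis .
    qed
    \<comment> \<open>The term of the difference at j = 0 is \<open>f \<xi>\<close> itself, so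
      \<open>S\<close> collects exactly the values controlled by \<open>point\<close>.\<close>
    define S where "S = (\<Sum>j\<in>{1..k}. of_nat (k choose j) * (- 1) ^ j * f (\<xi> + real j *\<^sub>R w))"
    have "(\<Sum>j\<le>k. of_nat (k choose j) * (- 1) ^ j * f (\<xi> + real j *\<^sub>R w)) = f \<xi> + S"
      unfolding S_def atMost_atLeast0 by (subst sum.atLeast_Suc_atMost) simp_all
    then have "norm (f \<xi> + S) \<le> (2 * pi * norm w * R) ^ k * m"
      using norm_fourier_difference_le[OF M R, of k \<xi> w] by (simp add: f_def m_def)
    then have "norm (f \<xi>) \<le> norm S + B * x powr (- s' / 2)"
      using error norm_triangle_ineq2[of "f \<xi>" "- S"] by simp
    also have "norm S \<le> (\<Sum>j\<in>{1..k}. real (k choose j) * (A * x powr (- s' / 2)))"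
      unfolding S_def
    proof (rule sum_norm_le)
      fix j assume "j \<in> {1..k}"
      then show "norm (of_nat (k choose j) * (- 1) ^ j * f (\<xi> + real j *\<^sub>R w))
          \<le> real (k choose j) * (A * x powr (- s' / 2))"
        using point[of j] by (simp add: norm_mult norm_power mult_left_mono)
    qed
    also have "\<dots> + B * x powr (- s' / 2)
        = ((\<Sum>j\<in>{1..k}. real (k choose j) * A) + B) * x powr (- s' / 2)"
      by (simp add: sum_distrib_right distrib_right mult.assoc)
    also have "\<dots> \<le> C' * x powr (- s' / 2)"
      by (intro mult_right_mono) (simp_all add: C'_def)
    finally show ?thesis
      by (simp add: x_def)
  qed
  then show ?thesis
    unfolding f_def by blast
qed

section \<open>Comparison of the Fourier dimensions\<close>

lemma lesssim_norm_power_iff: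
  fixes f :: "'a::real_normed_vector \<Rightarrow> complex"
  shows "f \<lesssim> norm_power a \<longleftrightarrow> (\<exists>C. \<forall>\<xi>. \<xi> \<noteq> 0 \<longrightarrow> norm (f \<xi>) \<le> C * norm \<xi> powr a)"
proof
  assume "f \<lesssim> norm_power a"
  then obtain C where C: "\<And>\<xi>. ereal (norm (f \<xi>)) \<le> ereal C * \<bar>norm_power a \<xi>\<bar>"
    by (auto simp: lesssim_def)
  have "norm (f \<xi>) \<le> C * norm \<xi> powr a" if "\<xi> \<noteq> 0" for \<xi>
    using C[of \<xi>] that by (simp add: norm_power_def)
  then show "\<exists>C. \<forall>\<xi>. \<xi> \<noteq> 0 \<longrightarrow> norm (f \<xi>) \<le> C * norm \<xi> powr a"
    by blast
next
  assume "\<exists>C. \<forall>\<xi>. \<xi> \<noteq> 0 \<longrightarrow> norm (f \<xi>) \<le> C * norm \<xi> powr a"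
  then obtain C where C: "\<And>\<xi>. \<xi> \<noteq> 0 \<Longrightarrow> norm (f \<xi>) \<le> C * norm \<xi> powr a"
    by blast
  \<comment> \<open>The constant must be positive, because 0 times infinity is 0 in
    \<open>ereal\<close>, and at least \<open>norm (f 0)\<close> for the case a = 0, where the power
    at the origin is 1.\<close>
  define D where "D = max 1 (max C (norm (f 0)))"
  have D: "0 < D" "norm (f 0) \<le> D"
    by (simp_all add: D_def)
  have "ereal (norm (f \<xi>)) \<le> ereal D * \<bar>norm_power a \<xi>\<bar>" for \<xi>
  proof (cases "\<xi> = 0")
    case True
    then show ?thesis
      using D by (simp add: norm_power_def)
  next
    case False
    have "norm (f \<xi>) \<le> D * norm \<xi> powr a"
      using C[OF False] by (rule order_trans) (simp add: D_def mult_right_mono)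
    with False show ?thesis
      by (simp add: norm_power_def)
  qed
  then show "f \<lesssim> norm_power a"
    by (auto simp: lesssim_def)
qed

theorem proposition12:
  fixes \<mu> :: "(real ^ 'n) measure" and t :: "real ^ 'n"
  assumes "finite_borel_measure \<mu>"
    and "compact (measure_support \<mu>)"
  shows "fourier_dim (add_measure \<mu> (translate_measure t \<mu>)) = fourier_dim \<mu>"
proof -
  let ?\<nu> = "add_measure \<mu> (translate_measure t \<mu>)"
  let ?\<phi> = "\<lambda>\<xi>. 1 + cis (- 2 * pi * (\<xi> \<bullet> t))"
  let ?d = "real DIM(real ^ 'n)"
  define S where "S M = {s \<in> {0..?d}. fourier_transform M \<lesssim> norm_power (- s / 2)}"
    for M :: "(real ^ 'n) measure"
  have dim: "fourier_dim M = Sup (S M)" for M :: "(real ^ 'n) measure"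
    by (simp add: fourier_dim_def S_def)
  note \<nu> = fourier_transform_add_translate[OF assms(1), of t]
  have bdd: "bdd_above (S M)" for M
    by (rule bdd_aboveI[of _ ?d]) (simp add: S_def)
  \<comment> \<open>The Fourier transform is bounded by the total mass. This makes the sets
    nonempty, so that their real suprema are meaningful.\<close>
  have zero: "0 \<in> S \<mu>"
    unfolding S_def lesssim_norm_power_iff
    using norm_fourier_transform_le[OF assms(1)] by (auto intro!: exI[of _ "measure \<mu> (space \<mu>)"])
  have sub: "S \<mu> \<subseteq> S ?\<nu>"
  proof
    fix s assume "s \<in> S \<mu>"
    then obtain C where s: "s \<in> {0..?d}"
      and C: "\<And>\<xi>. \<xi> \<noteq> 0 \<Longrightarrow> norm (fourier_transform \<mu> \<xi>) \<le> C * norm \<xi> powr (- s / 2)"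
      by (auto simp: S_def lesssim_norm_power_iff)
    have "norm (fourier_transform ?\<nu> \<xi>) \<le> (2 * C) * norm \<xi> powr (- s / 2)" if "\<xi> \<noteq> 0" for \<xi>
    proof -
      have "norm (?\<phi> \<xi>) \<le> 2"
        by (rule norm_triangle_le) simp
      then have "norm (?\<phi> \<xi>) * norm (fourier_transform \<mu> \<xi>) \<le> 2 * (C * norm \<xi> powr (- s / 2))"
        using C[OF that] by (intro mult_mono) auto
      then show ?thesis
        by (simp add: \<nu> norm_mult mult.assoc)
    qed
    with s show "s \<in> S ?\<nu>"
      by (auto simp: S_def lesssim_norm_power_iff)
  qed
  have interior: "s' \<in> S \<mu>" if t: "t \<noteq> 0" and s: "s \<in> S ?\<nu>" and s': "0 \<le> s'" "s' < s" for s s'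
  proof -
    from s obtain C where "s \<in> {0..?d}"
      and C: "\<And>\<xi>. \<xi> \<noteq> 0 \<Longrightarrow> norm (?\<phi> \<xi> * fourier_transform \<mu> \<xi>) \<le> C * norm \<xi> powr (- s / 2)"
      unfolding S_def lesssim_norm_power_iff \<nu> by blast
    obtain R where "0 < R" "\<And>x. x \<in> measure_support \<mu> \<Longrightarrow> norm x \<le> R"
      using compact_imp_bounded[OF assms(2)] by (auto simp: bounded_pos)
    moreover have "AE x in \<mu>. x \<in> measure_support \<mu>"
      using assms(1) by (intro AE_in_measure_support) (simp add: finite_borel_measure_def)
    ultimately have "AE x in \<mu>. norm x \<le> R" "0 \<le> R"
      by auto
    then have "\<exists>C'. \<forall>\<xi>. \<xi> \<noteq> 0 \<longrightarrow> norm (fourier_transform \<mu> \<xi>) \<le> C' * norm \<xi> powr (- s' / 2)"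
      using fourier_decay_from_translate_sum[OF assms(1) _ _ t s' C] by blast
    then show ?thesis
      using \<open>s \<in> {0..?d}\<close> s' by (simp add: S_def lesssim_norm_power_iff)
  qed
  \<comment> \<open>An exponent \<open>s\<close> of the sum is transferred only with a loss, so the
    suprema are compared through all s' < s; a negative s' is below the exponent 0.\<close>
  have "Sup (S ?\<nu>) \<le> Sup (S \<mu>)" if "t \<noteq> 0"
  proof (rule cSup_least)
    show "S ?\<nu> \<noteq> {}"
      using zero sub by blast
  next
    fix s assume s: "s \<in> S ?\<nu>"
    show "s \<le> Sup (S \<mu>)"
    proof (rule dense_le)
      fix s' assume "s' < s"
      show "s' \<le> Sup (S \<mu>)"
      proof (cases "0 \<le> s'")
        case True
        then show ?thesis
          using interior[OF that s] \<open>s' < s\<close> bdd by (intro cSup_upper)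
      next
        case False
        then show ?thesis
          using cSup_upper[OF zero bdd] by linarith
      qed
    qed
  qed
  \<comment> \<open>Without translation the factor is the constant 2, so every exponent transfers
    without loss.\<close>
  moreover have "Sup (S ?\<nu>) \<le> Sup (S \<mu>)" if "t = 0"
  proof (rule cSup_subset_mono)
    show "S ?\<nu> \<subseteq> S \<mu>"
    proof
      fix s assume "s \<in> S ?\<nu>"
      then obtain C where "s \<in> {0..?d}"
        and "\<And>\<xi>. \<xi> \<noteq> 0 \<Longrightarrow> 2 * norm (fourier_transform \<mu> \<xi>) \<le> C * norm \<xi> powr (- s / 2)"
        unfolding S_def lesssim_norm_power_iff \<nu> using \<open>t = 0\<close> by (auto simp: norm_mult)
      then have "norm (fourier_transform \<mu> \<xi>) \<le> (C / 2) * norm \<xi> powr (- s / 2)" if "\<xi> \<noteq> 0" for \<xi>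
        using that by (simp add: field_simps)
      with \<open>s \<in> {0..?d}\<close> show "s \<in> S \<mu>"
        unfolding S_def lesssim_norm_power_iff by blast
    qed
  qed (use zero sub bdd in auto)
  moreover have "Sup (S \<mu>) \<le> Sup (S ?\<nu>)"
    using zero sub bdd by (intro cSup_subset_mono) auto
  ultimately show ?thesis
    unfolding dim by (metis order_antisym)
qed

end
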